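(* Let $(\rho_*,m_* )\in\mathbb{R}^2$ with $\rho_*>0$ and $p'(\rho_* )>m_*^2/\rho_*^2$. The solutions $\widehat V=\widehat V(\xi,t)\in\mathbb{C}^2$ to the linear system $$\widehat V_t+\big(i\xi\widehat A(\xi)+\widehat B(\xi)\big)\widehat V=0$$ satisfy the pointwise estimate $$|\widehat V(\xi,t)|\le C\exp(-\omega_0\xi^2t)\,|\widehat V(\xi,0)|,$$ for all $\xi\in\mathbb{R}$, $t\ge0$ and some uniform constants $C,\omega_0>0$.
   Context: Here $p(\rho)=\rho^\gamma$ with $\gamma>1$, $\mu>0$ and $k>0$ are constants, and $$\widehat A(\xi)=\begin{pmatrix}0&\alpha(\xi)^{1/2}\\ \alpha(\xi)^{1/2}&2m_*/\rho_*\end{pmatrix},\quad \widehat B(\xi)=\xi^2\begin{pmatrix}0&0\\0&\mu\end{pmatrix},\quad \alpha(\xi)=p'(\rho_* )-\frac{m_*^2}{\rho_*^2}+\tfrac12k^2\xi^2.$$ "Uniform" means independent of $\xi$, $t$ and of the solution. *)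

theory Defs
  imports "HOL-Analysis.Analysis"
begin

definition pressure :: "real \<Rightarrow> real \<Rightarrow> real" where
  "pressure \<gamma> \<rho> = \<rho> powr \<gamma>"

definition alpha_sym :: "real \<Rightarrow> real \<Rightarrow> real \<Rightarrow> real \<Rightarrow> real \<Rightarrow> real" where
  "alpha_sym \<gamma> k \<rho> m \<xi> = deriv (pressure \<gamma>) \<rho> - m\<^sup>2 / \<rho>\<^sup>2 + 1/2 * k\<^sup>2 * \<xi>\<^sup>2"

definition A_hat :: "real \<Rightarrow> real \<Rightarrow> real \<Rightarrow> real \<Rightarrow> real \<Rightarrow> complex^2^2" where
  "A_hat \<gamma> k \<rho> m \<xi> =
     vector [vector [0, complex_of_real (sqrt (alpha_sym \<gamma> k \<rho> m \<xi>))],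
             vector [complex_of_real (sqrt (alpha_sym \<gamma> k \<rho> m \<xi>)), complex_of_real (2 * m / \<rho>)]]"

definition B_hat :: "real \<Rightarrow> real \<Rightarrow> complex^2^2" where
  "B_hat \<mu> \<xi> = \<xi>\<^sup>2 *\<^sub>R vector [vector [0, 0], vector [0, complex_of_real \<mu>]]"

text \<open>The matrix \<open>i\<xi>A + B\<close>, written entrywise because there is no multiplication of a
  complex matrix by a complex scalar.\<close>

definition system_matrix ::
    "real \<Rightarrow> real \<Rightarrow> real \<Rightarrow> real \<Rightarrow> real \<Rightarrow> real \<Rightarrow> complex^2^2" where
  "system_matrix \<gamma> \<mu> k \<rho> m \<xi> =
     (\<chi> i j. \<i> * complex_of_real \<xi> * A_hat \<gamma> k \<rho> m \<xi> $ i $ j + B_hat \<mu> \<xi> $ i $ j)"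

text \<open>A solution is defined for all frequencies \<open>\<xi>\<close> and all times \<open>t \<ge> 0\<close>, with a one-sided
  time derivative at \<open>t = 0\<close>. No regularity in \<open>\<xi>\<close> is imposed.\<close>

definition is_solution ::
    "real \<Rightarrow> real \<Rightarrow> real \<Rightarrow> real \<Rightarrow> real \<Rightarrow> (real \<Rightarrow> real \<Rightarrow> complex^2) \<Rightarrow> bool" where
  "is_solution \<gamma> \<mu> k \<rho> m V \<longleftrightarrow>
     (\<forall>\<xi>. \<forall>t\<ge>0. (V \<xi> has_vector_derivative - (system_matrix \<gamma> \<mu> k \<rho> m \<xi> *v V \<xi> t))
                   (at t within {0..}))"

end

theory Submission
  imports Defs
begin

text \<open>
  The viscosity damps only the second component: writing \<open>V = (u, v)\<close>, the matrix
  \<open>i\<xi>A\<close> is skew-Hermitian, so \<open>|u|\<^sup>2 + |v|\<^sup>2\<close> decreases at the rate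
  \<open>2\<mu>\<xi>\<^sup>2 |v|\<^sup>2\<close>, which says nothing about \<open>u\<close>. The missing damping comes from the coupling
  \<open>s = \<alpha>(\<xi>)\<^sup>1\<^sup>/\<^sup>2\<close> of the two components: the correlation \<open>w = Im (u v\<^sup>*)\<close> grows at the rate
  \<open>\<xi> s (|u|\<^sup>2 - |v|\<^sup>2)\<close> up to multiples of \<open>|u| |v|\<close> (\<open>correlation_has_derivative\<close>).
  Subtracting a small multiple of it gives the Lyapunov function
  \<open>E = |u|\<^sup>2 + |v|\<^sup>2 - \<epsilon> (\<xi>/s) w\<close>, where the weight \<open>\<xi>/s\<close>
  is chosen so that the gain is exactly \<open>\<epsilon> \<xi>\<^sup>2 |u|\<^sup>2\<close>. All error terms then carry the factor \<open>\<xi>\<^sup>2\<close>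
  as well, and \<open>\<xi>\<close> enters their coefficients only through \<open>1/s\<close> and \<open>\<xi>/s\<close>.

  Uniformity in \<open>\<xi>\<close> is where the hypotheses enter. Since
  \<open>\<alpha>(\<xi>) = a + k\<^sup>2\<xi>\<^sup>2/2\<close> with \<open>a > 0\<close>, the quotient \<open>1/s\<close> is bounded because \<open>a > 0\<close>, and
  \<open>\<xi>/s\<close> is bounded because \<open>k > 0\<close>: the capillarity makes the coupling grow linearly in the
  frequency, and keeps the quadratic damping rate even for large \<open>\<xi>\<close>. A single \<open>\<epsilon>\<close> therefore
  makes \<open>E\<close> comparable to \<open>|V|\<^sup>2\<close> (\<open>correlation_perturbation_bound\<close>) and its dissipation
  coercive (\<open>dissipation_coercive\<close>), so that \<open>E' \<le> - c \<xi>\<^sup>2 E\<close>, and Gronwall's inequality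
  yields the claim.
\<close>

lemma exponential_decay_of_differential_inequality:
  fixes E E' :: "real \<Rightarrow> real"
  assumes deriv: "\<And>t. t \<ge> 0 \<Longrightarrow> (E has_real_derivative E' t) (at t within {0..})"
    and le: "\<And>t. t \<ge> 0 \<Longrightarrow> E' t \<le> - c * E t"
    and "t \<ge> 0"
  shows "E t \<le> exp (- c * t) * E 0"
proof -
  define G where "G = (\<lambda>t. exp (c * t) * E t)"
  have dG: "(G has_real_derivative exp (c * s) * (c * E s + E' s)) (at s within {0..})"
    if "s \<ge> 0" for s
    unfolding G_def
    by (rule derivative_eq_intros deriv that refl | simp add: algebra_simps)+
  have "G t \<le> G 0"
  proof (rule DERIV_nonpos_imp_decreasing_open[OF \<open>t \<ge> 0\<close>])
    fix s assume s: "0 < s" "s < t"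
    have "at s within {0..} = at s"
      using s by (intro at_within_interior) (simp add: interior_Ici)
    moreover have "exp (c * s) * (c * E s + E' s) \<le> 0"
      using le[of s] s by (intro mult_nonneg_nonpos) auto
    ultimately show "\<exists>y. (G has_real_derivative y) (at s) \<and> y \<le> 0"
      using dG[of s] s by auto
  next
    have "continuous_on {0..} G"
      using dG by (intro DERIV_continuous_on) auto
    then show "continuous_on {0..t} G"
      by (rule continuous_on_subset) auto
  qed
  then show ?thesis
    by (simp add: G_def exp_minus field_simps)
qed

section \<open>The system for a single frequency\<close>

lemma norm_vec2_squared:
  fixes x :: "complex^2"
  shows "(norm x)\<^sup>2 = (cmod (x $ 1))\<^sup>2 + (cmod (x $ 2))\<^sup>2"
  by (simp add: norm_vec_def L2_set_def sum_2)

lemma solution_components: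
  assumes "is_solution \<gamma> \<mu> k \<rho> m V" and "t \<ge> 0"
  defines "s \<equiv> \<lambda>\<xi>. sqrt (alpha_sym \<gamma> k \<rho> m \<xi>)"
  shows "((\<lambda>t. V \<xi> t $ 1) has_vector_derivative
           - (\<i> * of_real (\<xi> * s \<xi>) * V \<xi> t $ 2)) (at t within {0..})"
    and "((\<lambda>t. V \<xi> t $ 2) has_vector_derivative
           - (\<i> * of_real (\<xi> * s \<xi>) * V \<xi> t $ 1)
           - (\<i> * of_real (\<xi> * (2 * m / \<rho>)) + of_real (\<mu> * \<xi>\<^sup>2)) * V \<xi> t $ 2)
           (at t within {0..})"
proof -
  have "(V \<xi> has_vector_derivative - (system_matrix \<gamma> \<mu> k \<rho> m \<xi> *v V \<xi> t)) (at t within {0..})"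
    using assms by (simp add: is_solution_def)
  then have comp: "((\<lambda>t. V \<xi> t $ i) has_vector_derivative
      (- (system_matrix \<gamma> \<mu> k \<rho> m \<xi> *v V \<xi> t)) $ i) (at t within {0..})" for i
    by (rule bounded_linear.has_vector_derivative[OF bounded_linear_vec_nth])
  have 1: "(- (system_matrix \<gamma> \<mu> k \<rho> m \<xi> *v V \<xi> t)) $ 1 = - (\<i> * of_real (\<xi> * s \<xi>) * V \<xi> t $ 2)"
    by (simp add: system_matrix_def A_hat_def B_hat_def matrix_vector_mult_def sum_2 s_def)
  have 2: "(- (system_matrix \<gamma> \<mu> k \<rho> m \<xi> *v V \<xi> t)) $ 2 =
      - (\<i> * of_real (\<xi> * s \<xi>) * V \<xi> t $ 1)
      - (\<i> * of_real (\<xi> * (2 * m / \<rho>)) + of_real (\<mu> * \<xi>\<^sup>2)) * V \<xi> t $ 2"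
    by (simp add: system_matrix_def A_hat_def B_hat_def matrix_vector_mult_def sum_2 s_def)
      (simp add: algebra_simps scaleR_conv_of_real)
  show "((\<lambda>t. V \<xi> t $ 1) has_vector_derivative
           - (\<i> * of_real (\<xi> * s \<xi>) * V \<xi> t $ 2)) (at t within {0..})"
    using comp[of 1] unfolding 1 .
  show "((\<lambda>t. V \<xi> t $ 2) has_vector_derivative
           - (\<i> * of_real (\<xi> * s \<xi>) * V \<xi> t $ 1)
           - (\<i> * of_real (\<xi> * (2 * m / \<rho>)) + of_real (\<mu> * \<xi>\<^sup>2)) * V \<xi> t $ 2)
           (at t within {0..})"
    using comp[of 2] unfolding 2 .
qed

lemma has_real_derivative_Re:
  assumes "(f has_vector_derivative f') F"
  shows "((\<lambda>x. Re (f x)) has_real_derivative Re f') F"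
  using bounded_linear.has_vector_derivative[OF bounded_linear_Re assms]
  by (simp add: has_real_derivative_iff_has_vector_derivative)

lemma has_real_derivative_Im:
  assumes "(f has_vector_derivative f') F"
  shows "((\<lambda>x. Im (f x)) has_real_derivative Im f') F"
  using bounded_linear.has_vector_derivative[OF bounded_linear_Im assms]
  by (simp add: has_real_derivative_iff_has_vector_derivative)

text \<open>
  The next two identities hold for any pair of modes coupled with strength \<open>\<sigma>\<close>, where the
  second one oscillates with frequency \<open>\<beta>\<close> and is damped at the rate \<open>\<nu>\<close>. The oscillation
  and the coupling are conservative, so that only the damping shows up in the energy balance.
\<close>

lemma energy_has_derivative:
  fixes u v :: "real \<Rightarrow> complex" and \<sigma> \<beta> \<nu> :: real
  assumes u: "(u has_vector_derivative - (\<i> * of_real \<sigma> * v t)) (at t within S)"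
    and v: "(v has_vector_derivative
        - (\<i> * of_real \<sigma> * u t) - (\<i> * of_real \<beta> + of_real \<nu>) * v t) (at t within S)"
  shows "((\<lambda>t. (cmod (u t))\<^sup>2 + (cmod (v t))\<^sup>2) has_real_derivative
           - 2 * \<nu> * (cmod (v t))\<^sup>2) (at t within S)"
  unfolding cmod_power2
  by (rule derivative_eq_intros refl has_real_derivative_Re[OF u] has_real_derivative_Re[OF v]
        has_real_derivative_Im[OF u] has_real_derivative_Im[OF v]
      | simp add: algebra_simps power2_eq_square)+

text \<open>
  For \<open>\<sigma> > 0\<close> the correlation is fed by the first component and drained by the second: this is the
  mechanism that transfers the damping of \<open>v\<close> to \<open>u\<close>.
\<close>

lemma correlation_has_derivative:
  fixes u v :: "real \<Rightarrow> complex" and \<sigma> \<beta> \<nu> :: real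
  assumes u: "(u has_vector_derivative - (\<i> * of_real \<sigma> * v t)) (at t within S)"
    and v: "(v has_vector_derivative
        - (\<i> * of_real \<sigma> * u t) - (\<i> * of_real \<beta> + of_real \<nu>) * v t) (at t within S)"
  shows "((\<lambda>t. Im (u t * cnj (v t))) has_real_derivative
           \<sigma> * ((cmod (u t))\<^sup>2 - (cmod (v t))\<^sup>2) + \<beta> * Re (u t * cnj (v t))
           - \<nu> * Im (u t * cnj (v t))) (at t within S)"
  unfolding cmod_power2 times_complex.sel cnj.sel
  by (rule derivative_eq_intros refl has_real_derivative_Re[OF u] has_real_derivative_Re[OF v]
        has_real_derivative_Im[OF u] has_real_derivative_Im[OF v]
      | simp add: algebra_simps power2_eq_square)+

section \<open>Coercivity with constants independent of the frequency\<close>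

lemma abs_Im_mult_cnj_le: "\<bar>Im (u * cnj v)\<bar> \<le> cmod u * cmod v"
  using abs_Im_le_cmod[of "u * cnj v"] by (simp add: norm_mult)

lemma abs_Re_mult_cnj_le: "\<bar>Re (u * cnj v)\<bar> \<le> cmod u * cmod v"
  using abs_Re_le_cmod[of "u * cnj v"] by (simp add: norm_mult)

lemma correlation_perturbation_bound:
  fixes u v :: complex and \<delta> :: real
  assumes "\<bar>\<delta>\<bar> \<le> 1"
  shows "\<bar>\<delta> * Im (u * cnj v)\<bar> \<le> ((cmod u)\<^sup>2 + (cmod v)\<^sup>2) / 2"
proof -
  have "\<bar>\<delta> * Im (u * cnj v)\<bar> \<le> 1 * (cmod u * cmod v)"
    unfolding abs_mult using assms abs_Im_mult_cnj_le by (intro mult_mono) auto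
  also have "\<dots> \<le> ((cmod u)\<^sup>2 + (cmod v)\<^sup>2) / 2"
    using sum_squares_bound[of "cmod u" "cmod v"] by simp
  finally show ?thesis .
qed

text \<open>
  The mixed terms are absorbed by \<open>K |u| |v| \<le> |u|\<^sup>2/2 + K\<^sup>2 |v|\<^sup>2/2\<close>. The first half costs half of
  the gain in \<open>u\<close>; the second one, together with the loss \<open>\<epsilon> |v|\<^sup>2\<close> of the correlation, is at most
  half of the viscous dissipation as soon as \<open>\<epsilon> (1 + K\<^sup>2) \<le> \<mu>\<close>.
\<close>

lemma dissipation_coercive:
  fixes u v :: complex and \<mu> \<epsilon> K \<beta> \<tau> :: real
  assumes K: "\<bar>\<beta>\<bar> + \<mu> * \<bar>\<tau>\<bar> \<le> K" and "\<mu> > 0" "\<epsilon> > 0" and \<epsilon>: "\<epsilon> * (1 + K\<^sup>2) \<le> \<mu>"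
  shows "- 2 * \<mu> * (cmod v)\<^sup>2
         - \<epsilon> * ((cmod u)\<^sup>2 - (cmod v)\<^sup>2 + \<beta> * Re (u * cnj v) - \<mu> * \<tau> * Im (u * cnj v))
         \<le> - (\<epsilon> / 2) * ((cmod u)\<^sup>2 + (cmod v)\<^sup>2)"
proof -
  define x y where "x = cmod u" and "y = cmod v"
  have "x \<ge> 0" "y \<ge> 0" by (simp_all add: x_def y_def)
  have "\<bar>\<beta> * Re (u * cnj v)\<bar> \<le> \<bar>\<beta>\<bar> * (x * y)"
    unfolding abs_mult x_def y_def using abs_Re_mult_cnj_le by (intro mult_left_mono) auto
  moreover have "\<bar>\<mu> * \<tau> * Im (u * cnj v)\<bar> \<le> \<mu> * \<bar>\<tau>\<bar> * (x * y)"
    unfolding abs_mult x_def y_def using abs_Im_mult_cnj_le \<open>\<mu> > 0\<close>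
    by (simp add: mult.assoc mult_left_mono)
  moreover have "(\<bar>\<beta>\<bar> + \<mu> * \<bar>\<tau>\<bar>) * (x * y) \<le> K * (x * y)"
    using K \<open>x \<ge> 0\<close> \<open>y \<ge> 0\<close> by (intro mult_right_mono) auto
  moreover have "K * (x * y) \<le> x\<^sup>2 / 2 + K\<^sup>2 * y\<^sup>2 / 2"
    using sum_squares_bound[of x "K * y"] by (simp add: power_mult_distrib mult_ac)
  ultimately have "- (\<beta> * Re (u * cnj v) - \<mu> * \<tau> * Im (u * cnj v)) \<le> x\<^sup>2 / 2 + K\<^sup>2 * y\<^sup>2 / 2"
    by (simp add: distrib_right)
  then have "\<epsilon> * (- (\<beta> * Re (u * cnj v) - \<mu> * \<tau> * Im (u * cnj v)))
      \<le> \<epsilon> * (x\<^sup>2 / 2 + K\<^sup>2 * y\<^sup>2 / 2)"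
    using \<open>\<epsilon> > 0\<close> by (intro mult_left_mono) auto
  moreover have "\<epsilon> * (1 + K\<^sup>2) * y\<^sup>2 \<le> \<mu> * y\<^sup>2"
    using \<epsilon> by (intro mult_right_mono) auto
  moreover have "\<epsilon> * y\<^sup>2 \<le> \<epsilon> * (1 + K\<^sup>2) * y\<^sup>2"
    using \<open>\<epsilon> > 0\<close> by (intro mult_right_mono) auto
  moreover have "0 \<le> \<mu> * y\<^sup>2"
    using \<open>\<mu> > 0\<close> by simp
  ultimately show ?thesis
    unfolding x_def[symmetric] y_def[symmetric] by (simp add: algebra_simps)
qed

text \<open>
  The two summands under the root control the two frequency regimes: the constant one bounds
  \<open>1/s\<close> at low frequencies, and the capillary one bounds \<open>\<xi>/s\<close> at high ones.
\<close>

lemma coupling_quotients_bounded: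
  fixes a k \<xi> :: real
  assumes "a > 0" and "k > 0"
  defines "s \<equiv> sqrt (a + 1/2 * k\<^sup>2 * \<xi>\<^sup>2)"
  shows "s > 0" and "1 / s \<le> 1 / sqrt a" and "\<bar>\<xi> / s\<bar> \<le> sqrt 2 / k"
proof -
  have pos: "a + 1/2 * k\<^sup>2 * \<xi>\<^sup>2 > 0"
    using assms by (intro add_pos_nonneg) auto
  then show "s > 0" by (simp add: s_def)
  have "sqrt a \<le> s" by (simp add: s_def)
  then show "1 / s \<le> 1 / sqrt a"
    using \<open>a > 0\<close> by (intro divide_left_mono) (auto simp: \<open>s > 0\<close>)
  have "\<bar>\<xi>\<bar> * k = sqrt 2 * sqrt (1/2 * k\<^sup>2 * \<xi>\<^sup>2)"
    using \<open>k > 0\<close> by (simp add: real_sqrt_mult real_sqrt_divide)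
  also have "\<dots> \<le> sqrt 2 * s"
    using \<open>a > 0\<close> by (simp add: s_def)
  finally show "\<bar>\<xi> / s\<bar> \<le> sqrt 2 / k"
    using \<open>k > 0\<close> \<open>s > 0\<close> by (simp add: field_simps abs_divide)
qed

section \<open>The decay estimate\<close>

text \<open>
  The Lyapunov argument at a fixed frequency. The constants depend on the coupling \<open>s\<close> only
  through the bound \<open>K\<close>, which is what makes the estimate uniform.
\<close>

lemma mode_decay:
  fixes u v :: "real \<Rightarrow> complex" and \<xi> s b \<mu> K t :: real
  assumes u: "\<And>t. t \<ge> 0 \<Longrightarrow>
      (u has_vector_derivative - (\<i> * of_real (\<xi> * s) * v t)) (at t within {0..})"
    and v: "\<And>t. t \<ge> 0 \<Longrightarrow> (v has_vector_derivative
        - (\<i> * of_real (\<xi> * s) * u t) - (\<i> * of_real (\<xi> * b) + of_real (\<mu> * \<xi>\<^sup>2)) * v t)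
        (at t within {0..})"
    and "s > 0" and "\<mu> > 0" and K: "\<bar>b / s\<bar> + \<mu> * \<bar>\<xi> / s\<bar> \<le> K" and "t \<ge> 0"
  defines "\<epsilon> \<equiv> \<mu> / (1 + K\<^sup>2)"
  shows "(cmod (u t))\<^sup>2 + (cmod (v t))\<^sup>2
         \<le> 3 * exp (- (\<epsilon> / 3 * \<xi>\<^sup>2) * t) * ((cmod (u 0))\<^sup>2 + (cmod (v 0))\<^sup>2)"
proof -
  define N where "N = (\<lambda>t. (cmod (u t))\<^sup>2 + (cmod (v t))\<^sup>2)"
  define w where "w = (\<lambda>t. Im (u t * cnj (v t)))"
  define r where "r = (\<lambda>t. Re (u t * cnj (v t)))"
  \<comment> \<open>The weight \<open>\<xi>/s\<close> turns the feeding term \<open>\<xi> s |u|\<^sup>2\<close> of the correlation into \<open>\<xi>\<^sup>2 |u|\<^sup>2\<close>.\<close>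
  define E where "E = (\<lambda>t. N t - \<epsilon> * (\<xi> / s) * w t)"
  define D where "D = (\<lambda>t. - 2 * \<mu> * (cmod (v t))\<^sup>2
      - \<epsilon> * ((cmod (u t))\<^sup>2 - (cmod (v t))\<^sup>2 + b / s * r t - \<mu> * (\<xi> / s) * w t))"
  have K1: "1 + K\<^sup>2 > 0" by (simp add: add_pos_nonneg)
  have "\<epsilon> > 0" using K1 \<open>\<mu> > 0\<close> by (simp add: \<epsilon>_def)
  have \<epsilon>K: "\<epsilon> * (1 + K\<^sup>2) = \<mu>" using K1 by (simp add: \<epsilon>_def)
  have "\<bar>\<epsilon> * (\<xi> / s)\<bar> \<le> 1"
  proof -
    have "\<mu> * \<bar>\<xi> / s\<bar> \<le> K" using K by linarith
    also have "K \<le> 1 + K\<^sup>2"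
      using sum_squares_bound[of K 1] by simp (smt (verit) zero_le_power2)
    finally have "\<mu> * \<bar>\<xi> / s\<bar> / (1 + K\<^sup>2) \<le> 1"
      using K1 by (simp only: divide_le_eq_1_pos)
    moreover have "\<bar>\<epsilon> * (\<xi> / s)\<bar> = \<mu> * \<bar>\<xi> / s\<bar> / (1 + K\<^sup>2)"
      using K1 \<open>\<mu> > 0\<close> by (simp add: \<epsilon>_def abs_mult)
    ultimately show ?thesis by simp
  qed
  then have "\<bar>\<epsilon> * (\<xi> / s) * w t\<bar> \<le> N t / 2" for t
    unfolding w_def N_def by (rule correlation_perturbation_bound)
  then have "\<bar>N t - E t\<bar> \<le> N t / 2" for t
    by (simp add: E_def)
  then have two_sided: "N t - E t \<le> N t / 2" "E t - N t \<le> N t / 2" for t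
    by (simp_all only: abs_le_iff minus_diff_eq)
  have N_le: "N t \<le> 2 * E t" for t
    using two_sided(1)[of t] by linarith
  have E_le: "E t \<le> 3 / 2 * N t" for t
    using two_sided(2)[of t] by linarith
  have dE: "(E has_real_derivative \<xi>\<^sup>2 * D t) (at t within {0..})" if "t \<ge> 0" for t
  proof -
    have "(E has_real_derivative - 2 * (\<mu> * \<xi>\<^sup>2) * (cmod (v t))\<^sup>2
        - \<epsilon> * (\<xi> / s) * (\<xi> * s * ((cmod (u t))\<^sup>2 - (cmod (v t))\<^sup>2) + \<xi> * b * r t
            - \<mu> * \<xi>\<^sup>2 * w t)) (at t within {0..})"
      unfolding E_def N_def w_def r_def
      by (intro DERIV_diff DERIV_cmult energy_has_derivative[OF u v]
          correlation_has_derivative[OF u v] that)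
    also have "- 2 * (\<mu> * \<xi>\<^sup>2) * (cmod (v t))\<^sup>2
        - \<epsilon> * (\<xi> / s) * (\<xi> * s * ((cmod (u t))\<^sup>2 - (cmod (v t))\<^sup>2) + \<xi> * b * r t
            - \<mu> * \<xi>\<^sup>2 * w t) = \<xi>\<^sup>2 * D t"
      using \<open>s > 0\<close> unfolding D_def by (simp add: field_simps power2_eq_square)
    finally show ?thesis .
  qed
  have "\<xi>\<^sup>2 * D t \<le> - (\<epsilon> / 3 * \<xi>\<^sup>2) * E t" for t
  proof -
    have "D t \<le> - (\<epsilon> / 2) * N t"
      unfolding D_def N_def r_def w_def
      by (rule dissipation_coercive[OF K]) (use \<open>\<mu> > 0\<close> \<open>\<epsilon> > 0\<close> \<epsilon>K in auto)
    also have "\<dots> = - (\<epsilon> / 3) * (3 / 2 * N t)" by simp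
    also have "\<dots> \<le> - (\<epsilon> / 3) * E t"
      using E_le \<open>\<epsilon> > 0\<close> by (intro mult_left_mono_neg) auto
    finally have "\<xi>\<^sup>2 * D t \<le> \<xi>\<^sup>2 * (- (\<epsilon> / 3) * E t)"
      by (intro mult_left_mono) auto
    then show ?thesis by (simp add: mult_ac)
  qed
  then have decay: "E t \<le> exp (- (\<epsilon> / 3 * \<xi>\<^sup>2) * t) * E 0"
    by (intro exponential_decay_of_differential_inequality[where E' = "\<lambda>t. \<xi>\<^sup>2 * D t"] dE \<open>t \<ge> 0\<close>)
  have "N t \<le> 2 * E t"
    by (rule N_le)
  also have "\<dots> \<le> 2 * (exp (- (\<epsilon> / 3 * \<xi>\<^sup>2) * t) * (3 / 2 * N 0))"
  proof -
    have "exp (- (\<epsilon> / 3 * \<xi>\<^sup>2) * t) * E 0 \<le> exp (- (\<epsilon> / 3 * \<xi>\<^sup>2) * t) * (3 / 2 * N 0)"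
      using E_le by (intro mult_left_mono) auto
    with decay show ?thesis by linarith
  qed
  finally show ?thesis by (simp add: N_def algebra_simps)
qed

theorem lemma11:
  fixes \<gamma> \<mu> k \<rho>s ms :: real
  assumes "\<gamma> > 1" and "\<mu> > 0" and "k > 0"
    and "\<rho>s > 0"
    and "deriv (pressure \<gamma>) \<rho>s > ms\<^sup>2 / \<rho>s\<^sup>2"
  shows "\<exists>C>0. \<exists>\<omega>0>0. \<forall>V :: real \<Rightarrow> real \<Rightarrow> complex^2.
           is_solution \<gamma> \<mu> k \<rho>s ms V \<longrightarrow>
           (\<forall>\<xi>. \<forall>t\<ge>0. norm (V \<xi> t) \<le> C * exp (- \<omega>0 * \<xi>\<^sup>2 * t) * norm (V \<xi> 0))"
proof -
  define a where "a = deriv (pressure \<gamma>) \<rho>s - ms\<^sup>2 / \<rho>s\<^sup>2"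
  define b where "b = 2 * ms / \<rho>s"
  define K where "K = \<bar>b\<bar> / sqrt a + \<mu> * (sqrt 2 / k)"
  define \<epsilon> where "\<epsilon> = \<mu> / (1 + K\<^sup>2)"
  have "a > 0" using assms by (simp add: a_def)
  have "\<epsilon> > 0" using \<open>\<mu> > 0\<close> by (simp add: \<epsilon>_def add_pos_nonneg)
  have "norm (V \<xi> t) \<le> sqrt 3 * exp (- (\<epsilon> / 6) * \<xi>\<^sup>2 * t) * norm (V \<xi> 0)"
    if V: "is_solution \<gamma> \<mu> k \<rho>s ms V" and "t \<ge> 0" for V \<xi> t
  proof -
    define s where "s = sqrt (alpha_sym \<gamma> k \<rho>s ms \<xi>)"
    have s_eq: "s = sqrt (a + 1/2 * k\<^sup>2 * \<xi>\<^sup>2)"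
      by (simp add: s_def alpha_sym_def a_def)
    note quot = coupling_quotients_bounded[OF \<open>a > 0\<close> \<open>k > 0\<close>, of \<xi>, folded s_eq]
    have "\<bar>b / s\<bar> \<le> \<bar>b\<bar> / sqrt a"
      using mult_left_mono[OF quot(2), of "\<bar>b\<bar>"] quot(1) by (simp add: abs_divide)
    moreover have "\<mu> * \<bar>\<xi> / s\<bar> \<le> \<mu> * (sqrt 2 / k)"
      using quot(3) \<open>\<mu> > 0\<close> by (intro mult_left_mono) auto
    ultimately have "\<bar>b / s\<bar> + \<mu> * \<bar>\<xi> / s\<bar> \<le> K"
      unfolding K_def by linarith
    then have "(norm (V \<xi> t))\<^sup>2 \<le> 3 * exp (- (\<epsilon> / 3 * \<xi>\<^sup>2) * t) * (norm (V \<xi> 0))\<^sup>2"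
      unfolding norm_vec2_squared \<epsilon>_def
      by (intro mode_decay[where s = s and b = b] quot(1) \<open>\<mu> > 0\<close> \<open>t \<ge> 0\<close>
          solution_components[OF V, where \<xi> = \<xi>, folded s_def b_def])
    also have "\<dots> = (sqrt 3 * exp (- (\<epsilon> / 6) * \<xi>\<^sup>2 * t) * norm (V \<xi> 0))\<^sup>2"
      by (simp add: power_mult_distrib flip: exp_double)
    finally show ?thesis
      by (rule power2_le_imp_le) simp
  qed
  moreover have "sqrt 3 > (0::real)" "\<epsilon> / 6 > 0"
    using \<open>\<epsilon> > 0\<close> by simp_all
  ultimately show ?thesis by blast
qed

end
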